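(* Let $\mathbb{X}=\mathbb{Y}$ be a real Hilbert space, let $\mathbb{J}$ be a finite nonempty set and let $\mathbb{W}$ be a set. 1. Let $\{W_j\}_{j\in\mathbb{J}}$ be a family of pairwise disjoint subsets of $\mathbb{W}$. 2. Let $\{\theta_j\}_{j\in\mathbb{J}}$ be a family of mappings $\theta_j:W_j\to\mathbb{X}$ such that (a) $\sum_{j\in\mathbb{J}}\mathrm{span}\big(\theta_j(W_j)\big)=\mathbb{X}$; (b) for every $j\in\mathbb{J}$, the subset $\theta_j(W_j)$ of $\mathbb{X}$ is symmetric and weakly bounded. 3. Let $h:\mathbb{W}\to\overline{\mathbb{R}}$ be a function such that $(\theta_j\rhd h)^{\star}$ is proper for every $j\in\mathbb{J}$, and $\bigcap_{j\in\mathbb{J}}\mathrm{dom}\,(\theta_j\rhd h)^{\star}\neq\emptyset$. Then there exists a norm $|||\cdot|||$ on $\mathbb{X}$, with unit ball $\overline{\mathrm{co}}\big(-\bigcup_{j\in\mathbb{J}}\theta_j(W_j)\big)$, such that we have the lower bound $$\min_{|||x|||\le1}\Big(\sup_{j\in\mathbb{J}}(\theta_j\rhd h)^{\star}\Big)^{\star}(x)\;\le\;\inf_{w\in\bigcup_{j\in\mathbb{J}}W_j}h(w).$$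
   Context: $\overline{\mathbb{R}}=[-\infty,+\infty]$. Infimal postcomposition: for $\theta_j:W_j\to\mathbb{X}$, $(\theta_j\rhd h)(x)=\inf\{h(w):w\in W_j,\ \theta_j(w)=x\}$ for $x\in\mathbb{X}$, with $\inf\emptyset=+\infty$. Fenchel conjugate of $f:\mathbb{X}\to\overline{\mathbb{R}}$ (with respect to the scalar product $\langle\cdot,\cdot\rangle$): $f^{\star}(y)=\sup_{x\in\mathbb{X}}\big(\langle x,y\rangle\underset{\cdot}{+}(-f(x))\big)$, where $\underset{\cdot}{+}$ is the addition on $\overline{\mathbb{R}}$ with $(+\infty)\underset{\cdot}{+}(-\infty)=-\infty$. The same formula defines the conjugate of a function on $\mathbb{Y}=\mathbb{X}$. $\mathrm{dom}\,f=\{x:f(x)<+\infty\}$; $f$ is proper if $\mathrm{dom}\,f\ne\emptyset$ and $f$ never takes the value $-\infty$. A set $X\subset\mathbb{X}$ is symmetric if $-X=X$, and weakly bounded if $\sup_{x\in X}\langle x,y\rangle<+\infty$ for all $y\in\mathbb{Y}$. $\mathrm{span}$ is the linear span, $\overline{\mathrm{co}}$ the closed convex hull. The unit ball of a norm is the closed one, $\{x:|||x|||\le1\}$. "min" means that the infimum is attained. *)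

theory Defs
  imports "HOL-Analysis.Analysis" "HOL-Library.Set_Algebras"
begin

text \<open>Lower addition on the extended reals. The library addition on \<open>ereal\<close> is the upper one
  (\<open>\<infinity> + (-\<infinity>) = \<infinity>\<close>), so it is modified to make \<open>-\<infinity>\<close> absorbing.\<close>

definition lower_add :: "ereal \<Rightarrow> ereal \<Rightarrow> ereal"
  where "lower_add a b = (if a = -\<infinity> \<or> b = -\<infinity> then -\<infinity> else a + b)"

definition fenchel_conjugate :: "('a::real_inner \<Rightarrow> ereal) \<Rightarrow> 'a \<Rightarrow> ereal"
  where "fenchel_conjugate f y = (SUP x. lower_add (ereal (inner x y)) (- f x))"

text \<open>A mapping \<open>\<theta>\<close> from \<open>W\<close> is encoded as a total function whose values off \<open>W\<close> are never used.
  The infimum of the empty set is \<open>\<infinity>\<close> in \<open>ereal\<close>.\<close>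

definition inf_postcomp :: "'w set \<Rightarrow> ('w \<Rightarrow> 'a) \<Rightarrow> ('w \<Rightarrow> ereal) \<Rightarrow> 'a \<Rightarrow> ereal"
  where "inf_postcomp W \<theta> h x = (INF w\<in>{w \<in> W. \<theta> w = x}. h w)"

definition effective_dom :: "('a \<Rightarrow> ereal) \<Rightarrow> 'a set"
  where "effective_dom f = {x. f x < \<infinity>}"

definition proper_fun :: "('a \<Rightarrow> ereal) \<Rightarrow> bool"
  where "proper_fun f \<longleftrightarrow> effective_dom f \<noteq> {} \<and> (\<forall>x. f x \<noteq> -\<infinity>)"

definition symmetric_set :: "'a::real_vector set \<Rightarrow> bool"
  where "symmetric_set X \<longleftrightarrow> uminus ` X = X"

definition weakly_bounded :: "'a::real_inner set \<Rightarrow> bool"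
  where "weakly_bounded X \<longleftrightarrow> (\<forall>y. (SUP x\<in>X. ereal (inner x y)) < \<infinity>)"

text \<open>The norm of the type class is the Hilbert norm; other norms on the same space are functions
  satisfying the norm axioms.\<close>

definition is_norm :: "('a::real_vector \<Rightarrow> real) \<Rightarrow> bool"
  where "is_norm N \<longleftrightarrow>
    (\<forall>x. 0 \<le> N x) \<and> (\<forall>x. N x = 0 \<longleftrightarrow> x = 0) \<and>
    (\<forall>x y. N (x + y) \<le> N x + N y) \<and> (\<forall>c x. N (c *\<^sub>R x) = \<bar>c\<bar> * N x)"

definition unit_ball :: "('a \<Rightarrow> real) \<Rightarrow> 'a set"
  where "unit_ball N = {x. N x \<le> 1}"

end

(* The union S of the sets theta_j(W_j) is symmetric, spans the space and, by the uniform
   boundedness principle, is bounded; so the Minkowski gauge of its closed convex hull B is a norm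
   with unit ball B. A conjugate function has closed convex sublevel sets, hence attains its
   infimum on the bounded closed convex set B. For the lower bound evaluate at x = theta_j w,
   which lies in B: with f_j the infimal postcomposition, F x \<le> (f_j)** x \<le> f_j x \<le> h w. *)

theory Submission
  imports Defs
begin

section \<open>Uniform boundedness of symmetric sets\<close>

text \<open>Baire category argument: the closed sets \<open>E n\<close> cover the complete space, so
  one of them contains a ball, on which all functionals \<open>inner x\<close> with \<open>x\<close>
  in \<open>S\<close> are bounded by the same \<open>n\<close>. Symmetry turns the one-sided bounds
  of weak boundedness into the two-sided bounds in \<open>E n\<close>.\<close>

lemma weakly_bounded_imp_bounded:
  fixes S :: "'a::{real_inner, complete_space} set"
  assumes sym: "symmetric_set S" and wb: "weakly_bounded S"
  shows "bounded S"
proof -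
  define E where "E n = {y. \<forall>x\<in>S. \<bar>inner x y\<bar> \<le> real n}" for n
  have "closed {y. \<bar>inner x y\<bar> \<le> real n}" for n and x :: 'a
    by (intro closed_Collect_le continuous_intros)
  then have closed_E: "closed (E n)" for n
    unfolding E_def Collect_ball_eq by (intro closed_INT) auto
  have cover: "(\<Union>n. E n) = UNIV"
  proof (rule UNIV_eq_I[symmetric])
    fix y
    have less: "(SUP x\<in>S. ereal (inner x y)) < \<infinity>"
      using wb by (simp add: weakly_bounded_def)
    obtain n :: nat where n: "(SUP x\<in>S. ereal (inner x y)) \<le> ereal (real n)"
    proof (cases "SUP x\<in>S. ereal (inner x y)")
      case (real r)
      then show ?thesis using that real_arch_simple[of r] by auto
    next
      case PInf
      then show ?thesis using less by simp
    next
      case MInf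
      \<comment> \<open>The supremum is \<open>-\<infinity>\<close> only for empty \<open>S\<close>,
        and then any \<open>n\<close> serves.\<close>
      then show ?thesis using that[of 0] by simp
    qed
    have le: "inner x y \<le> real n" if "x \<in> S" for x
      using n that by (simp add: SUP_le_iff)
    have "\<bar>inner x y\<bar> \<le> real n" if "x \<in> S" for x
    proof -
      have "- x \<in> S"
        using sym that by (auto simp: symmetric_set_def)
      then show ?thesis using le[OF that] le[of "- x"] by (simp add: abs_le_iff)
    qed
    then show "y \<in> (\<Union>n. E n)" by (auto simp: E_def)
  qed
  have "\<exists>n. interior (E n) \<noteq> {}"
  proof (rule ccontr)
    assume "\<not> ?thesis"
    then have "Met_TC.mtopology interior_of \<Union>(range E) = {}"
      using closed_E
      by (intro Met_TC.metric_Baire_category_alt) (auto simp: complete_UNIV)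
    then show False
      using cover by simp
  qed
  then obtain n y r where r: "r > 0" "cball y r \<subseteq> E n"
    by (metis ex_in_conv mem_interior_cball)
  \<comment> \<open>The step from the centre \<open>y\<close> to the boundary point in direction
    \<open>x\<close> has inner product \<open>r * norm x\<close> with \<open>x\<close>. Both ends
    lie in \<open>E n\<close>, so this is at most \<open>2 * real n\<close>.\<close>
  have "norm x \<le> 2 * real n / r" if "x \<in> S" for x
  proof (cases "x = 0")
    case False
    have y: "y \<in> E n" using r by auto
    have z: "y + (r / norm x) *\<^sub>R x \<in> E n"
      using r False by (intro subsetD[OF r(2)]) (auto simp: dist_norm)
    have "r * norm x = inner x ((y + (r / norm x) *\<^sub>R x) - y)"
      using False by (simp add: dot_square_norm power2_eq_square)
    also have "\<dots> = inner x (y + (r / norm x) *\<^sub>R x) - inner x y"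
      by (simp add: inner_diff_right inner_add_right)
    also have "\<dots> \<le> 2 * real n"
    proof -
      have "\<bar>inner x y\<bar> \<le> real n" "\<bar>inner x (y + (r / norm x) *\<^sub>R x)\<bar> \<le> real n"
        using y z that by (auto simp: E_def)
      then show ?thesis by linarith
    qed
    finally show ?thesis using r(1) by (simp add: field_simps)
  qed (use r in simp)
  then show ?thesis by (auto simp: bounded_iff)
qed

section \<open>The Minkowski gauge as a norm\<close>

text \<open>The positive dilation factors of \<open>B\<close> that reach \<open>x\<close>. Keeping
  the set apart from its infimum lets the algebra be done on single factors.\<close>

definition gauge_times :: "'a::real_vector set \<Rightarrow> 'a \<Rightarrow> real set"
  where "gauge_times B x = {t. 0 < t \<and> x /\<^sub>R t \<in> B}"

definition minkowski_gauge :: "'a::real_vector set \<Rightarrow> 'a \<Rightarrow> real"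
  where "minkowski_gauge B x = Inf (gauge_times B x)"

lemma bdd_below_gauge_times: "bdd_below (gauge_times B x)"
  by (rule bdd_belowI[of _ 0]) (auto simp: gauge_times_def)

text \<open>\<open>x /\<^sub>R s\<close> lies on the segment from \<open>0\<close> to
  \<open>x /\<^sub>R t\<close>.\<close>

lemma gauge_times_mono:
  assumes "convex B" "0 \<in> B" "t \<in> gauge_times B x" "t \<le> s"
  shows "s \<in> gauge_times B x"
proof -
  have t: "0 < t" "x /\<^sub>R t \<in> B" using assms by (auto simp: gauge_times_def)
  have "(t / s) *\<^sub>R (x /\<^sub>R t) + (1 - t / s) *\<^sub>R 0 \<in> B"
    using t assms by (intro convexD) auto
  then show ?thesis using t assms by (auto simp: gauge_times_def field_simps)
qed

text \<open>\<open>(x + y) /\<^sub>R (s + t)\<close> is the convex combination of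
  \<open>x /\<^sub>R s\<close> and \<open>y /\<^sub>R t\<close> with weights proportional to
  \<open>s\<close> and \<open>t\<close>. This is the source of the triangle inequality.\<close>

lemma gauge_times_add:
  assumes "convex B" "s \<in> gauge_times B x" "t \<in> gauge_times B y"
  shows "s + t \<in> gauge_times B (x + y)"
proof -
  have st: "0 < s" "0 < t" "x /\<^sub>R s \<in> B" "y /\<^sub>R t \<in> B"
    using assms by (auto simp: gauge_times_def)
  have "(s / (s + t)) *\<^sub>R (x /\<^sub>R s) + (t / (s + t)) *\<^sub>R (y /\<^sub>R t) \<in> B"
    using st assms by (intro convexD) (auto simp: add_divide_distrib[symmetric])
  also have "(s / (s + t)) *\<^sub>R (x /\<^sub>R s) + (t / (s + t)) *\<^sub>R (y /\<^sub>R t) = (x + y) /\<^sub>R (s + t)"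
  proof -
    have "s / (s + t) * inverse s = inverse (s + t)" "t / (s + t) * inverse t = inverse (s + t)"
      using st by (simp_all add: divide_inverse)
    then show ?thesis by (simp add: scaleR_add_right)
  qed
  finally show ?thesis using st by (auto simp: gauge_times_def)
qed

lemma gauge_times_scale:
  assumes "uminus ` B \<subseteq> B" "c \<noteq> 0" "t \<in> gauge_times B x"
  shows "\<bar>c\<bar> * t \<in> gauge_times B (c *\<^sub>R x)"
proof -
  have t: "0 < t" "x /\<^sub>R t \<in> B" using assms by (auto simp: gauge_times_def)
  then have "- (x /\<^sub>R t) \<in> B" using assms by blast
  moreover have "(c *\<^sub>R x) /\<^sub>R (\<bar>c\<bar> * t) = (if c > 0 then x /\<^sub>R t else - (x /\<^sub>R t))"
    using assms t by (auto simp: field_simps abs_if)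
  ultimately show ?thesis using t assms by (auto simp: gauge_times_def)
qed

lemma gauge_times_0: "0 \<in> B \<Longrightarrow> gauge_times B 0 = {0<..}"
  by (auto simp: gauge_times_def)

text \<open>The vectors reached by some dilate of \<open>B\<close> form a subspace containing
  \<open>B\<close>. Nonemptiness matters because \<open>Inf\<close> of an empty set of reals carries
  no information.\<close>

lemma gauge_times_nonempty_span:
  assumes "convex B" "0 \<in> B" "uminus ` B \<subseteq> B" "x \<in> span B"
  shows "gauge_times B x \<noteq> {}"
proof -
  have "subspace {x. gauge_times B x \<noteq> {}}"
  proof (rule subspaceI)
    show "0 \<in> {x. gauge_times B x \<noteq> {}}" using gauge_times_0[OF assms(2)] by auto
  next
    fix x y assume "x \<in> {x. gauge_times B x \<noteq> {}}" "y \<in> {x. gauge_times B x \<noteq> {}}"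
    then show "x + y \<in> {x. gauge_times B x \<noteq> {}}" using gauge_times_add[OF assms(1)] by blast
  next
    fix c x assume *: "x \<in> {x. gauge_times B x \<noteq> {}}"
    show "c *\<^sub>R x \<in> {x. gauge_times B x \<noteq> {}}"
    proof (cases "c = 0")
      case True
      then show ?thesis using gauge_times_0[OF assms(2)] by auto
    next
      case False
      then show ?thesis using * gauge_times_scale[OF assms(3)] by blast
    qed
  qed
  moreover have "1 \<in> gauge_times B x" if "x \<in> B" for x
    using that by (simp add: gauge_times_def)
  then have "B \<subseteq> {x. gauge_times B x \<noteq> {}}" by blast
  ultimately show ?thesis using assms(4) span_minimal by blast
qed

text \<open>Convexity gives the triangle inequality, symmetry the homogeneity, boundedness the
  definiteness, and the spanning condition makes every infimum one over a nonempty set.\<close>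

lemma minkowski_gauge_is_norm:
  fixes B :: "'a::real_normed_vector set"
  assumes "convex B" "0 \<in> B" "uminus ` B \<subseteq> B" "bounded B" "span B = UNIV"
  shows "is_norm (minkowski_gauge B)"
proof -
  let ?T = "gauge_times B" and ?N = "minkowski_gauge B"
  have ne: "?T x \<noteq> {}" for x
    using gauge_times_nonempty_span[of B x] assms by auto
  have lower: "?N x \<le> t" if "t \<in> ?T x" for x t
    unfolding minkowski_gauge_def by (rule cInf_lower[OF that bdd_below_gauge_times])
  have nonneg: "0 \<le> ?N x" for x
    unfolding minkowski_gauge_def using ne by (intro cInf_greatest) (auto simp: gauge_times_def)
  have zero: "?N 0 = 0"
    by (simp add: minkowski_gauge_def gauge_times_0[OF assms(2)])
  have approx: "\<exists>t\<in>?T x. t < ?N x + e" if "0 < e" for x e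
    using cInf_lessD[OF ne[of x], of "?N x + e"] that by (auto simp: minkowski_gauge_def)
  have tri: "?N (x + y) \<le> ?N x + ?N y" for x y
  proof (rule field_le_epsilon)
    fix e :: real assume "0 < e"
    then obtain s t where st: "s \<in> ?T x" "t \<in> ?T y" "s < ?N x + e / 2" "t < ?N y + e / 2"
      using approx[of "e / 2" x] approx[of "e / 2" y] by auto
    have "?N (x + y) \<le> s + t" by (intro lower gauge_times_add assms st)
    then show "?N (x + y) \<le> ?N x + ?N y + e" using st by linarith
  qed
  have scale_le: "?N (c *\<^sub>R x) \<le> \<bar>c\<bar> * ?N x" if "c \<noteq> 0" for c x
  proof -
    have "?N (c *\<^sub>R x) / \<bar>c\<bar> \<le> ?N x"
      unfolding minkowski_gauge_def[of B x]
    proof (intro cInf_greatest ne)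
      fix t assume "t \<in> ?T x"
      then show "?N (c *\<^sub>R x) / \<bar>c\<bar> \<le> t"
        using lower[OF gauge_times_scale[OF assms(3) that]] that by (simp add: field_simps)
    qed
    then show ?thesis using that by (simp add: field_simps)
  qed
  have scale: "?N (c *\<^sub>R x) = \<bar>c\<bar> * ?N x" for c x
  proof (cases "c = 0")
    case False
    \<comment> \<open>The reverse inequality is \<open>scale_le\<close> itself, applied to the
      inverse scalar and the scaled vector.\<close>
    have "?N x \<le> ?N (c *\<^sub>R x) / \<bar>c\<bar>"
      using scale_le[of "inverse c" "c *\<^sub>R x"] False by (simp add: field_simps)
    then show ?thesis using scale_le[OF False, of x] False by (simp add: field_simps)
  qed (simp add: zero)
  obtain M where M: "M > 0" "\<And>x. x \<in> B \<Longrightarrow> norm x \<le> M"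
    using assms(4) bounded_pos by blast
  have definite: "x = 0" if "?N x = 0" for x
  proof -
    \<comment> \<open>If \<open>x /\<^sub>R t\<close> is in \<open>B\<close>, its norm is at most
      \<open>M\<close>, so \<open>norm x / M\<close> bounds every admissible \<open>t\<close> from
      below.\<close>
    have "norm x / M \<le> ?N x"
      unfolding minkowski_gauge_def
    proof (intro cInf_greatest ne)
      fix t assume "t \<in> ?T x"
      then show "norm x / M \<le> t"
        using M(1) M(2)[of "x /\<^sub>R t"] by (simp add: gauge_times_def field_simps)
    qed
    then show ?thesis using that M(1) by (simp add: field_simps)
  qed
  show ?thesis
    unfolding is_norm_def using nonneg zero definite tri scale by blast
qed

text \<open>For gauge at most 1, every factor above 1 is admissible, although 1 itself is not yet
  known to be. Letting the factors \<open>1 + inverse (real (Suc n))\<close> decrease to 1,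
  closedness puts the limit \<open>x\<close> in \<open>B\<close>.\<close>

lemma unit_ball_minkowski_gauge:
  fixes B :: "'a::real_normed_vector set"
  assumes "convex B" "0 \<in> B" "uminus ` B \<subseteq> B" "closed B" "span B = UNIV"
  shows "unit_ball (minkowski_gauge B) = B"
proof
  show "B \<subseteq> unit_ball (minkowski_gauge B)"
    by (auto simp: unit_ball_def minkowski_gauge_def gauge_times_def
        intro!: cInf_lower[OF _ bdd_below_gauge_times, unfolded gauge_times_def])
next
  show "unit_ball (minkowski_gauge B) \<subseteq> B"
  proof
    fix x assume x: "x \<in> unit_ball (minkowski_gauge B)"
    have ne: "gauge_times B x \<noteq> {}"
      using gauge_times_nonempty_span[of B x] assms by auto
    have mem: "x /\<^sub>R (1 + inverse (real (Suc n))) \<in> B" for n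
    proof -
      have "Inf (gauge_times B x) < 1 + inverse (real (Suc n))"
        using x by (simp add: unit_ball_def minkowski_gauge_def add_pos_pos le_less_trans)
      then obtain t where "t \<in> gauge_times B x" "t < 1 + inverse (real (Suc n))"
        using cInf_lessD[OF ne] by blast
      then have "1 + inverse (real (Suc n)) \<in> gauge_times B x"
        using gauge_times_mono[OF assms(1,2)] by (meson less_imp_le)
      then show ?thesis by (simp add: gauge_times_def)
    qed
    have "(\<lambda>n. x /\<^sub>R (1 + inverse (real (Suc n)))) \<longlonglongrightarrow> x /\<^sub>R (1 + 0)"
      by (intro tendsto_intros LIMSEQ_inverse_real_of_nat) simp
    then show "x \<in> B"
      using closed_sequentially[OF assms(4)] mem by fastforce
  qed
qed

section \<open>Attainment of minima on bounded closed convex sets\<close>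

(* Near-minimizers of the norm on the sets C n form a Cauchy sequence, by the parallelogram law. *)
lemma decreasing_closed_convex_Inter_nonempty:
  fixes C :: "nat \<Rightarrow> 'a::{real_inner, complete_space} set"
  assumes cl: "\<And>n. closed (C n)" and cv: "\<And>n. convex (C n)" and ne: "\<And>n. C n \<noteq> {}"
    and dec: "decseq C" and bd: "bounded (C 0)"
  shows "(\<Inter>n. C n) \<noteq> {}"
proof -
  \<comment> \<open>The squared distance of \<open>C n\<close> from the origin. It increases as the
    sets shrink and is bounded because all of them lie in \<open>C 0\<close>, so it
    converges.\<close>
  define q where "q n = (INF x\<in>C n. (norm x)\<^sup>2)" for n
  have bdd: "bdd_below ((\<lambda>x. (norm x)\<^sup>2) ` C n)" for n
    by (rule bdd_belowI[of _ 0]) auto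
  have q_le: "q n \<le> (norm x)\<^sup>2" if "x \<in> C n" for n x
    unfolding q_def using bdd that by (rule cINF_lower)
  have sub: "C n \<subseteq> C m" if "m \<le> n" for m n
    using dec that by (simp add: decseqD)
  have "incseq q"
    unfolding q_def incseq_def
    by (intro allI impI cINF_superset_mono) (use ne bdd sub in auto)
  moreover obtain M where M: "\<And>x. x \<in> C 0 \<Longrightarrow> norm x \<le> M"
    using bd by (auto simp: bounded_iff)
  have "q n \<le> M\<^sup>2" for n
  proof -
    obtain x where x: "x \<in> C n" using ne[of n] by auto
    then have "norm x \<le> M" using M sub[of 0 n] by auto
    then show ?thesis using q_le[OF x] power_mono[of "norm x" M 2] by simp
  qed
  ultimately have "convergent q"
    by (metis incseq_convergent convergentI)
  then have "Cauchy q" by (rule convergent_Cauchy)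
  have "\<exists>x. x \<in> C n \<and> (norm x)\<^sup>2 < q n + inverse (real (Suc n))" for n
  proof -
    have "q n < q n + inverse (real (Suc n))" by simp
    then show ?thesis
      unfolding q_def using cINF_less_iff[OF ne bdd] by blast
  qed
  then obtain X where X: "\<And>n. X n \<in> C n" "\<And>n. (norm (X n))\<^sup>2 < q n + inverse (real (Suc n))"
    by metis
  \<comment> \<open>For \<open>m \<le> n\<close> the midpoint of \<open>X m\<close> and
    \<open>X n\<close> lies in \<open>C m\<close>, so its squared norm is at least
    \<open>q m\<close>. The parallelogram law converts this into closeness of the two
    points.\<close>
  have dist_X: "(norm (X m - X n))\<^sup>2 \<le> 2 * (q n - q m) + 4 * inverse (real (Suc m))"
    if "m \<le> n" for m n
  proof -
    have "(1/2) *\<^sub>R X m + (1/2) *\<^sub>R X n \<in> C m"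
      using X(1)[of m] X(1)[of n] sub[OF that] by (intro convexD[OF cv]) auto
    then have "q m \<le> (norm ((1/2) *\<^sub>R (X m + X n)))\<^sup>2"
      using q_le by (simp add: scaleR_add_right)
    also have "\<dots> = (norm (X m + X n))\<^sup>2 / 4"
      by (simp add: power_divide)
    finally have "4 * q m \<le> (norm (X m + X n))\<^sup>2" by simp
    moreover have "(norm (X m - X n))\<^sup>2 + (norm (X m + X n))\<^sup>2 = 2 * (norm (X m))\<^sup>2 + 2 * (norm (X n))\<^sup>2"
      by (simp add: power2_norm_eq_inner inner_diff_left inner_diff_right inner_add_left
          inner_add_right inner_commute)
    moreover have "inverse (real (Suc n)) \<le> inverse (real (Suc m))"
      using that by (intro le_imp_inverse_le) auto
    ultimately show ?thesis
      using X(2)[of m] X(2)[of n] by argo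
  qed
  have "Cauchy X"
  proof (rule metric_CauchyI)
    fix e :: real assume e: "0 < e"
    \<comment> \<open>The thresholds are chosen to fit \<open>dist_X\<close>:
      \<open>2 * (e\<^sup>2 / 4) + 4 * (e\<^sup>2 / 8) = e\<^sup>2\<close>.\<close>
    obtain N1 where N1: "\<And>m n. m \<ge> N1 \<Longrightarrow> n \<ge> N1 \<Longrightarrow> \<bar>q n - q m\<bar> < e\<^sup>2 / 4"
      using metric_CauchyD[OF \<open>Cauchy q\<close>, of "e\<^sup>2 / 4"] e by (auto simp: dist_real_def)
    obtain N2 where N2: "inverse (real (Suc N2)) < e\<^sup>2 / 8"
      using reals_Archimedean[of "e\<^sup>2 / 8"] e by auto
    have close: "norm (X m - X n) < e" if "max N1 N2 \<le> m" "m \<le> n" for m n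
    proof -
      have "inverse (real (Suc m)) \<le> inverse (real (Suc N2))"
        using that by (intro le_imp_inverse_le) auto
      moreover have "q n - q m < e\<^sup>2 / 4"
        using that by (intro le_less_trans[OF abs_ge_self N1]) auto
      ultimately have "(norm (X m - X n))\<^sup>2 < e\<^sup>2"
        using dist_X[OF that(2)] N2 by argo
      then show ?thesis using e by (simp add: power_less_imp_less_base)
    qed
    have "dist (X m) (X n) < e" if "max N1 N2 \<le> m" "max N1 N2 \<le> n" for m n
      using close[of m n] close[of n m] that
      by (cases "m \<le> n") (auto simp: dist_norm norm_minus_commute)
    then show "\<exists>M. \<forall>m\<ge>M. \<forall>n\<ge>M. dist (X m) (X n) < e" by blast
  qed
  then obtain x where x: "X \<longlonglongrightarrow> x"
    by (auto simp: Cauchy_convergent_iff convergent_def)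
  have "x \<in> C n" for n
  proof (rule Lim_in_closed_set[OF cl _ _ x])
    show "\<forall>\<^sub>F k in sequentially. X k \<in> C n"
      using eventually_ge_at_top[of n] by eventually_elim (use X(1) sub in blast)
  qed simp
  then show ?thesis by auto
qed

text \<open>A point common to the sublevel sets of a minimizing sequence of values is a minimizer.
  Intersections of decreasing closed convex bounded sets supply it, with no weak topology, and
  infinite values of \<open>F\<close> need no separate case.\<close>

lemma quasiconvex_lsc_attains_INF:
  fixes F :: "'a::{real_inner, complete_space} \<Rightarrow> ereal"
  assumes sub: "\<And>c. closed {x. F x \<le> c}" "\<And>c. convex {x. F x \<le> c}"
    and B: "closed B" "convex B" "bounded B" "B \<noteq> {}"
  shows "\<exists>x\<in>B. F x = (INF x\<in>B. F x)"
proof -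
  obtain u where u: "\<And>n. u n \<in> F ` B" "u \<longlonglongrightarrow> (INF x\<in>B. F x)"
    using Inf_as_limit[of "F ` B"] B(4) by auto
  \<comment> \<open>The sequence \<open>u\<close> need not be monotone; intersecting over all
    \<open>k\<close> up to \<open>n\<close> makes \<open>C\<close> decreasing. Since each
    \<open>u k\<close> is a value of \<open>F\<close> on \<open>B\<close>, a point realizing the
    least of them lies in \<open>C n\<close>.\<close>
  define C where "C n = B \<inter> (\<Inter>k\<in>{..n}. {x. F x \<le> u k})" for n
  have "(\<Inter>n. C n) \<noteq> {}"
  proof (rule decreasing_closed_convex_Inter_nonempty)
    show "closed (C n)" for n
      unfolding C_def using B sub by (intro closed_Int closed_INT) auto
    show "convex (C n)" for n
      unfolding C_def using B sub by (intro convex_Int convex_INT) auto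
    show "C n \<noteq> {}" for n
    proof -
      have "Min (u ` {..n}) \<in> u ` {..n}" by (intro Min_in) auto
      then obtain x where "x \<in> B" "F x = Min (u ` {..n})" using u(1) by (metis imageE)
      then have "x \<in> C n" by (auto simp: C_def)
      then show ?thesis by blast
    qed
    show "decseq C" by (force simp: decseq_def C_def)
    show "bounded (C 0)" using B(3) by (auto simp: C_def)
  qed
  then obtain x where x: "\<And>n. x \<in> C n" by blast
  have "F x \<le> (INF x\<in>B. F x)"
  proof (rule LIMSEQ_le_const[OF u(2)])
    show "\<exists>N. \<forall>n\<ge>N. F x \<le> u n" using x by (auto simp: C_def)
  qed
  moreover have "x \<in> B" using x[of 0] by (simp add: C_def)
  ultimately show ?thesis by (meson INF_lower antisym)
qed

section \<open>Fenchel conjugates\<close>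

text \<open>A sublevel set of a supremum is the intersection of those of its terms. Each is a closed
  half-space when \<open>g y\<close> and \<open>c\<close> are finite, and otherwise empty or the
  whole space.\<close>

lemma fenchel_conjugate_sublevel:
  fixes g :: "'a::real_inner \<Rightarrow> ereal"
  shows "closed {x. fenchel_conjugate g x \<le> c}" "convex {x. fenchel_conjugate g x \<le> c}"
proof -
  have eq: "{x. fenchel_conjugate g x \<le> c} = (\<Inter>y. {x. lower_add (ereal (inner y x)) (- g y) \<le> c})"
    by (auto simp: fenchel_conjugate_def SUP_le_iff)
  have "closed {x. lower_add (ereal (inner y x)) (- g y) \<le> c} \<and>
        convex {x. lower_add (ereal (inner y x)) (- g y) \<le> c}" for y
  proof (cases "g y")
    case (real r)
    show ?thesis
    proof (cases c)
      case c: (real s)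
      have "{x. lower_add (ereal (inner y x)) (- g y) \<le> c} = {x. inner y x \<le> s + r}"
        using real c by (auto simp: lower_add_def)
      then show ?thesis by (simp add: closed_halfspace_le convex_halfspace_le)
    qed (use real in \<open>auto simp: lower_add_def\<close>)
  qed (auto simp: lower_add_def)
  then show "closed {x. fenchel_conjugate g x \<le> c}" "convex {x. fenchel_conjugate g x \<le> c}"
    unfolding eq by (auto intro: closed_INT convex_INT)
qed

text \<open>The Fenchel-Young inequality with \<open>f x\<close> and the conjugate exchanged; the
  case split justifies the exchange for infinite values.\<close>

lemma fenchel_biconjugate_le: "fenchel_conjugate (fenchel_conjugate f) x \<le> f x"
proof -
  have "lower_add (ereal (inner y x)) (- fenchel_conjugate f y) \<le> f x" for y
  proof -
    have "lower_add (ereal (inner x y)) (- f x) \<le> fenchel_conjugate f y"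
      unfolding fenchel_conjugate_def by (rule SUP_upper) simp
    then show ?thesis
      by (cases "f x"; cases "fenchel_conjugate f y") (auto simp: lower_add_def inner_commute)
  qed
  then show ?thesis
    unfolding fenchel_conjugate_def[of "fenchel_conjugate f"] by (simp add: SUP_le_iff)
qed

lemma fenchel_conjugate_antimono:
  assumes "\<And>y. f y \<le> g y"
  shows "fenchel_conjugate g x \<le> fenchel_conjugate f x"
  unfolding fenchel_conjugate_def
proof (intro SUP_mono')
  fix y
  show "lower_add (ereal (inner y x)) (- g y) \<le> lower_add (ereal (inner y x)) (- f y)"
    using assms[of y] by (cases "f y"; cases "g y") (auto simp: lower_add_def)
qed

text \<open>Over an empty \<open>W\<close> the postcomposition is constantly
  \<open>\<infinity>\<close>, so its conjugate is constantly \<open>-\<infinity>\<close>. In the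
  theorem this provides a point of the unit ball.\<close>

lemma proper_conjugate_imp_nonempty:
  assumes "proper_fun (fenchel_conjugate (inf_postcomp W \<theta> h))"
  shows "W \<noteq> {}"
proof
  assume "W = {}"
  then have "fenchel_conjugate (inf_postcomp W \<theta> h) x = -\<infinity>" for x
    by (simp add: fenchel_conjugate_def inf_postcomp_def lower_add_def top_ereal_def)
  then show False using assms by (simp add: proper_fun_def)
qed

theorem proposition13:
  fixes \<W> :: "'w set"
    and J :: "'j set"
    and W :: "'j \<Rightarrow> 'w set"
    and \<theta> :: "'j \<Rightarrow> 'w \<Rightarrow> 'a::{real_inner, complete_space}"
    and h :: "'w \<Rightarrow> ereal"
  assumes "finite J" and "J \<noteq> {}"
    and "\<And>j. j \<in> J \<Longrightarrow> W j \<subseteq> \<W>"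
    and "disjoint_family_on W J"
    and "(\<Sum>j\<in>J. span (\<theta> j ` W j)) = UNIV"
    and "\<And>j. j \<in> J \<Longrightarrow> symmetric_set (\<theta> j ` W j)"
    and "\<And>j. j \<in> J \<Longrightarrow> weakly_bounded (\<theta> j ` W j)"
    and "\<And>j. j \<in> J \<Longrightarrow> proper_fun (fenchel_conjugate (inf_postcomp (W j) (\<theta> j) h))"
    and "(\<Inter>j\<in>J. effective_dom (fenchel_conjugate (inf_postcomp (W j) (\<theta> j) h))) \<noteq> {}"
  defines "F \<equiv> fenchel_conjugate (\<lambda>y. SUP j\<in>J. fenchel_conjugate (inf_postcomp (W j) (\<theta> j) h) y)"
  shows "\<exists>N :: 'a \<Rightarrow> real. is_norm N
    \<and> unit_ball N = closure (convex hull (uminus ` (\<Union>j\<in>J. \<theta> j ` W j)))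
    \<and> (\<exists>x\<^sub>0\<in>unit_ball N. F x\<^sub>0 = (INF x\<in>unit_ball N. F x))
    \<and> (INF x\<in>unit_ball N. F x) \<le> (INF w\<in>(\<Union>j\<in>J. W j). h w)"
proof -
  define S where "S = (\<Union>j\<in>J. \<theta> j ` W j)"
  define B where "B = closure (convex hull S)"
  have sym_j: "- x \<in> \<theta> j ` W j" if "j \<in> J" "x \<in> \<theta> j ` W j" for j x
    using assms(6)[OF that(1)] that(2) by (auto simp: symmetric_set_def)
  then have sym: "- x \<in> S" if "x \<in> S" for x
    using that unfolding S_def by blast
  have uminus_S: "uminus ` S = S"
    using sym by (force simp: image_iff)
  have "S \<noteq> {}"
    using assms(2) proper_conjugate_imp_nonempty[OF assms(8)] by (auto simp: S_def)
  then obtain s where s: "s \<in> S" by blast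
  have S_B: "S \<subseteq> B"
    unfolding B_def using hull_subset closure_subset by (rule subset_trans)
  have "bounded S"
    unfolding S_def using assms(1,6,7) by (intro bounded_UN ballI weakly_bounded_imp_bounded)
  then have B: "closed B" "convex B" "bounded B"
    by (auto simp: B_def bounded_convex_hull bounded_closure convex_closure)
  \<comment> \<open>Negation commutes with convex hulls by linearity and maps a closure into the
    closure of the image by continuity.\<close>
  have uminus_B: "uminus ` B \<subseteq> B"
    using closure_bounded_linear_image_subset[OF bounded_linear_minus[OF bounded_linear_ident],
        of "convex hull S"] convex_hull_linear_image[of uminus S]
    by (simp add: B_def uminus_S linear_uminus)
  \<comment> \<open>The origin is the midpoint of \<open>s\<close> and its opposite.\<close>
  have "(1/2) *\<^sub>R s + (1/2) *\<^sub>R (- s) \<in> B"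
    using s sym S_B by (intro convexD[OF B(2)]) auto
  then have zero: "0 \<in> B" by simp
  have "x \<in> span B" for x
  proof -
    have "x \<in> (\<Sum>j\<in>J. span (\<theta> j ` W j))" using assms(5) by simp
    then obtain v where v: "x = sum v J" "\<And>j. j \<in> J \<Longrightarrow> v j \<in> span (\<theta> j ` W j)"
      by (auto simp: set_sum_alt[OF assms(1)])
    have "v j \<in> span B" if "j \<in> J" for j
      using v(2)[OF that] span_mono[of "\<theta> j ` W j" B] S_B that by (auto simp: S_def)
    then show ?thesis unfolding v(1) by (rule span_sum)
  qed
  then have span: "span B = UNIV" by auto
  define N where "N = minkowski_gauge B"
  have norm: "is_norm N"
    unfolding N_def by (intro minkowski_gauge_is_norm B zero uminus_B span)
  have ball: "unit_ball N = B"
    unfolding N_def by (intro unit_ball_minkowski_gauge B zero uminus_B span)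
  have attained: "\<exists>x\<^sub>0\<in>B. F x\<^sub>0 = (INF x\<in>B. F x)"
    unfolding F_def
    by (intro quasiconvex_lsc_attains_INF fenchel_conjugate_sublevel B) (use zero in auto)
  have bound: "(INF x\<in>B. F x) \<le> h w" if w: "j \<in> J" "w \<in> W j" for j w
  proof -
    let ?f = "inf_postcomp (W j) (\<theta> j) h"
    have "\<theta> j w \<in> B" using w S_B by (auto simp: S_def)
    then have "(INF x\<in>B. F x) \<le> F (\<theta> j w)" by (rule INF_lower)
    also have "\<dots> \<le> fenchel_conjugate (fenchel_conjugate ?f) (\<theta> j w)"
      unfolding F_def by (intro fenchel_conjugate_antimono SUP_upper w)
    also have "\<dots> \<le> ?f (\<theta> j w)" by (rule fenchel_biconjugate_le)
    also have "\<dots> \<le> h w" unfolding inf_postcomp_def using w by (intro INF_lower) auto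
    finally show ?thesis .
  qed
  have "(INF x\<in>B. F x) \<le> (INF w\<in>(\<Union>j\<in>J. W j). h w)"
    using bound by (intro INF_greatest) auto
  \<comment> \<open>By symmetry of \<open>S\<close>, the sign in the required hull makes no
    difference.\<close>
  moreover have "B = closure (convex hull (uminus ` (\<Union>j\<in>J. \<theta> j ` W j)))"
    using uminus_S by (simp add: B_def S_def)
  ultimately show ?thesis
    using norm ball attained by (intro exI[of _ N]) simp
qed

end
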